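(* Let $\Omega$ be a compact metric space and let $\varphi$ be a random product of maps on a compact metric space $(X,d)$ over an invertible and ergodic measure-preserving dynamical system $(\Omega,\mathscr{F},\mathbb{P},\theta)$, where $\mathscr{F}$ is the Borel $\sigma$-algebra of $\Omega$. Suppose that the skew product $F_\varphi$ induced by $\varphi$ is continuous, that there exists an invariant graph, and that there is a unique $\varphi$-invariant measure. Then $\varphi$ is strongly synchronizing on average.
   Context: Setting. $(\Omega,\mathscr{F},\mathbb{P},\theta)$ is a measure-preserving dynamical system: $\mathbb{P}$ is a probability measure and $\theta\colon\Omega\to\Omega$ is measurable and preserves $\mathbb{P}$; invertible means that $\theta$ is a bijection with measurable inverse. $(X,d)$ is a compact metric space with Borel $\sigma$-algebra $\mathscr{B}$, and $f\colon\Omega\times X\to X$ is $\mathscr{F}\otimes\mathscr{B}/\mathscr{B}$-measurable; write $f_\omega(x)=f(\omega,x)$. The random product of maps over $(\Omega,\mathscr{F},\mathbb{P},\theta)$ is $\varphi(n,\omega,x)=f_\omega^n(x)=f_{\theta^{n-1}(\omega)}\circ\cdots\circ f_\omega(x)$ for $n\ge1$, with $f_\omega^0=\mathrm{id}$. The induced skew product is $F_\varphi\colon\Omega\times X\to\Omega\times X$, $F_\varphi(\omega,x)=(\theta(\omega),f_\omega(x))$. A probability measure $\mu$ on $\Omega\times X$ is $\varphi$-invariant if it is $F_\varphi$-invariant and $(\Pi_1)_*\mu=\mathbb{P}$, where $\Pi_1(\omega,x)=\omega$. An invariant map is a measurable map $\Phi\colon\Omega\to X$ with $f_\omega(\Phi(\omega))=\Phi(\theta(\omega))$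 for $\mathbb{P}$-almost every $\omega$; an invariant graph is the graph of an invariant map. $\varphi$ is strongly synchronizing on average if for $\mathbb{P}$-almost every $\omega$ one has $\lim_{n\to\infty}\frac1n\sum_{i=0}^{n-1}d(f_\omega^i(x),f_\omega^i(y))=0$ for every $x,y\in X$. *)

theory Defs
  imports "HOL-Probability.Probability"
begin

definition measure_preserving_system :: "'w measure \<Rightarrow> ('w \<Rightarrow> 'w) \<Rightarrow> bool" where
  "measure_preserving_system P \<theta> \<longleftrightarrow>
     prob_space P \<and> \<theta> \<in> measurable P P \<and> distr P P \<theta> = P"

definition invertible_system :: "'w measure \<Rightarrow> ('w \<Rightarrow> 'w) \<Rightarrow> bool" where
  "invertible_system P \<theta> \<longleftrightarrow>
     measure_preserving_system P \<theta> \<and>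
     bij_betw \<theta> (space P) (space P) \<and>
     inv_into (space P) \<theta> \<in> measurable P P"

definition ergodic_system :: "'w measure \<Rightarrow> ('w \<Rightarrow> 'w) \<Rightarrow> bool" where
  "ergodic_system P \<theta> \<longleftrightarrow>
     measure_preserving_system P \<theta> \<and>
     (\<forall>A\<in>sets P. \<theta> -` A \<inter> space P = A \<longrightarrow> measure P A = 0 \<or> measure P A = 1)"

text \<open>
  A random product of maps \<open>\<phi>\<close> is represented by its data \<open>(P, \<theta>, f)\<close>, where \<open>f \<omega> x\<close> is
  \<open>f\<^sub>\<omega>(x)\<close>. The fibre space is a whole type carrying its Borel \<open>\<sigma>\<close>-algebra.
\<close>

definition random_product_of_maps ::
  "'w measure \<Rightarrow> ('w \<Rightarrow> 'w) \<Rightarrow> ('w \<Rightarrow> 'x::topological_space \<Rightarrow> 'x) \<Rightarrow> bool" where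
  "random_product_of_maps P \<theta> f \<longleftrightarrow>
     measure_preserving_system P \<theta> \<and>
     (\<lambda>(\<omega>, x). f \<omega> x) \<in> measurable (P \<Otimes>\<^sub>M borel) borel"

primrec random_product ::
  "('w \<Rightarrow> 'w) \<Rightarrow> ('w \<Rightarrow> 'x \<Rightarrow> 'x) \<Rightarrow> nat \<Rightarrow> 'w \<Rightarrow> 'x \<Rightarrow> 'x" where
  "random_product \<theta> f 0 \<omega> x = x"
| "random_product \<theta> f (Suc n) \<omega> x = f ((\<theta> ^^ n) \<omega>) (random_product \<theta> f n \<omega> x)"

definition skew_product ::
  "('w \<Rightarrow> 'w) \<Rightarrow> ('w \<Rightarrow> 'x \<Rightarrow> 'x) \<Rightarrow> 'w \<times> 'x \<Rightarrow> 'w \<times> 'x" where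
  "skew_product \<theta> f = (\<lambda>(\<omega>, x). (\<theta> \<omega>, f \<omega> x))"

text \<open>
  Fixing the \<open>\<sigma>\<close>-algebra of \<open>\<mu>\<close> to be exactly the product one makes equality of the type
  \<open>measure\<close> agree with equality of measures, so that uniqueness can be expressed by \<open>\<exists>!\<close>.
\<close>

definition invariant_measure ::
  "'w measure \<Rightarrow> ('w \<Rightarrow> 'w) \<Rightarrow> ('w \<Rightarrow> 'x::topological_space \<Rightarrow> 'x) \<Rightarrow> ('w \<times> 'x) measure \<Rightarrow> bool" where
  "invariant_measure P \<theta> f \<mu> \<longleftrightarrow>
     prob_space \<mu> \<and> sets \<mu> = sets (P \<Otimes>\<^sub>M borel) \<and>
     distr \<mu> \<mu> (skew_product \<theta> f) = \<mu> \<and>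
     distr \<mu> P fst = P"

definition invariant_map ::
  "'w measure \<Rightarrow> ('w \<Rightarrow> 'w) \<Rightarrow> ('w \<Rightarrow> 'x::topological_space \<Rightarrow> 'x) \<Rightarrow> ('w \<Rightarrow> 'x) \<Rightarrow> bool" where
  "invariant_map P \<theta> f \<Phi> \<longleftrightarrow>
     \<Phi> \<in> measurable P borel \<and> (AE \<omega> in P. f \<omega> (\<Phi> \<omega>) = \<Phi> (\<theta> \<omega>))"

definition invariant_graph ::
  "'w measure \<Rightarrow> ('w \<Rightarrow> 'w) \<Rightarrow> ('w \<Rightarrow> 'x::topological_space \<Rightarrow> 'x) \<Rightarrow> ('w \<times> 'x) set \<Rightarrow> bool" where
  "invariant_graph P \<theta> f G \<longleftrightarrow>
     (\<exists>\<Phi>. invariant_map P \<theta> f \<Phi> \<and> G = (\<lambda>\<omega>. (\<omega>, \<Phi> \<omega>)) ` space P)"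

definition strongly_synchronizing_on_average ::
  "'w measure \<Rightarrow> ('w \<Rightarrow> 'w) \<Rightarrow> ('w \<Rightarrow> 'x::metric_space \<Rightarrow> 'x) \<Rightarrow> bool" where
  "strongly_synchronizing_on_average P \<theta> f \<longleftrightarrow>
     (AE \<omega> in P. \<forall>x y.
        (\<lambda>n. (1 / real n) *
           (\<Sum>i<n. dist (random_product \<theta> f i \<omega> x) (random_product \<theta> f i \<omega> y)))
        \<longlonglongrightarrow> 0)"

end

theory Submission
  imports Defs
begin

text \<open>
  Suppose that for a Birkhoff-generic \<open>\<omega>\<close> the averages of \<open>d (f\<^sub>\<omega>\<^sup>i x) (f\<^sub>\<omega>\<^sup>i y)\<close> do not tend to \<open>0\<close>.
  Take an ultrafilter on the naturals, finer than the tail filter, along which they stay above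
  some \<open>e > 0\<close>. Limits of frequencies along it give a shift-invariant finitely additive probability on
  the subsets of the naturals; on the clopen subsets of the space of all ultrafilters this is a
  countably additive premeasure by compactness, so it extends to a shift-invariant measure \<open>M\<close>.

  Every sequence in a compact metric space extends to that space of ultrafilters by taking limits.
  Extending the orbits of \<open>\<omega>\<close>, \<open>x\<close> and \<open>y\<close> to functions \<open>W\<close>, \<open>X\<close> and \<open>Y\<close>, continuity of the skew
  product makes the laws of \<open>(W, X)\<close> and \<open>(W, Y)\<close> under \<open>M\<close> invariant, and genericity makes \<open>P\<close>
  their marginal. By uniqueness both equal the measure carried by the invariant graph, so \<open>X = \<Phi> W = Y\<close>
  almost surely. But the indices with \<open>d (f\<^sub>\<omega>\<^sup>i x) (f\<^sub>\<omega>\<^sup>i y) \<ge> e / 2\<close> have positive limit frequency, a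
  contradiction. The ultrafilters replace weak compactness of the space of probability measures.
\<close>

subsection \<open>The ergodic theorem\<close>

text \<open>The maximum of the Birkhoff sums of lengths 0 to \<open>n\<close>. The recursion exposes
  its relation to the maximum started at \<open>\<theta> \<omega>\<close>.\<close>

fun birkhoff_max :: "('w \<Rightarrow> 'w) \<Rightarrow> ('w \<Rightarrow> real) \<Rightarrow> nat \<Rightarrow> 'w \<Rightarrow> real" where
  "birkhoff_max \<theta> h 0 \<omega> = 0"
| "birkhoff_max \<theta> h (Suc n) \<omega> = max 0 (h \<omega> + birkhoff_max \<theta> h n (\<theta> \<omega>))"

lemma birkhoff_max_nonneg: "birkhoff_max \<theta> h n \<omega> \<ge> 0"
  by (cases n) auto

lemma birkhoff_sum_Suc:
  fixes h :: "'w \<Rightarrow> real"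
  shows "(\<Sum>i<Suc n. h ((\<theta> ^^ i) \<omega>)) = h \<omega> + (\<Sum>i<n. h ((\<theta> ^^ i) (\<theta> \<omega>)))"
  by (subst sum.lessThan_Suc_shift) (simp add: funpow_swap1)

lemma birkhoff_sum_le_max: "(\<Sum>i<n. h ((\<theta> ^^ i) \<omega>)) \<le> birkhoff_max \<theta> h n \<omega>"
proof (induction n arbitrary: \<omega>)
  case (Suc n)
  show ?case
    unfolding birkhoff_sum_Suc using Suc[of "\<theta> \<omega>"] by simp
qed simp

lemma birkhoff_max_mono_Suc: "birkhoff_max \<theta> h n \<omega> \<le> birkhoff_max \<theta> h (Suc n) \<omega>"
proof (induction n arbitrary: \<omega>)
  case (Suc n)
  show ?case
    using Suc[of "\<theta> \<omega>"] by (simp add: max.coboundedI2 max.mono del: birkhoff_max.simps(1))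
qed simp

lemma birkhoff_max_mono: "m \<le> n \<Longrightarrow> birkhoff_max \<theta> h m \<omega> \<le> birkhoff_max \<theta> h n \<omega>"
  by (rule lift_Suc_mono_le[of "\<lambda>n. birkhoff_max \<theta> h n \<omega>"]) (rule birkhoff_max_mono_Suc)

lemma birkhoff_max_le:
  assumes "\<And>\<omega>. \<bar>h \<omega>\<bar> \<le> B"
  shows "birkhoff_max \<theta> h n \<omega> \<le> n * B"
proof (induction n arbitrary: \<omega>)
  case (Suc n)
  have "0 \<le> B" using assms[of undefined] by linarith
  then show ?case
    using Suc[of "\<theta> \<omega>"] assms[of \<omega>] by (auto simp: algebra_simps abs_le_iff)
qed simp

text \<open>
  Garsia's argument: where \<open>birkhoff_max \<theta> h n\<close> is positive, it exceeds its composition with \<open>\<theta>\<close>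
  by at most \<open>h\<close>, and the two have the same integral.
\<close>

lemma maximal_ergodic_inequality:
  fixes h :: "'w \<Rightarrow> real"
  assumes sys: "measure_preserving_system P \<theta>"
    and h [measurable]: "h \<in> borel_measurable P" and B: "\<And>\<omega>. \<bar>h \<omega>\<bar> \<le> B"
  shows "(\<integral>\<omega>. h \<omega> * indicator {\<omega>. birkhoff_max \<theta> h n \<omega> > 0} \<omega> \<partial>P) \<ge> 0"
proof -
  interpret prob_space P using sys by (simp add: measure_preserving_system_def)
  have [measurable]: "\<theta> \<in> measurable P P" and pres: "distr P P \<theta> = P"
    using sys by (auto simp: measure_preserving_system_def)
  let ?M = "\<lambda>n. birkhoff_max \<theta> h n"
  have [measurable]: "?M n \<in> borel_measurable P" for n
  proof (induction n)
    case (Suc n)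
    note this [measurable]
    show ?case by (subst birkhoff_max.simps(2)[abs_def]) measurable
  qed (simp add: birkhoff_max.simps(1)[abs_def])
  have int: "integrable P (?M n)" for n
    by (rule integrable_const_bound[where B = "n * B"])
      (auto simp: birkhoff_max_nonneg intro!: birkhoff_max_le B)
  have "integral\<^sup>L (distr P P \<theta>) (?M n) = (\<integral>\<omega>. ?M n (\<theta> \<omega>) \<partial>P)"
    by (rule integral_distr) auto
  then have eq: "(\<integral>\<omega>. ?M n (\<theta> \<omega>) \<partial>P) = integral\<^sup>L P (?M n)"
    by (simp add: pres)
  have int': "integrable P (\<lambda>\<omega>. ?M n (\<theta> \<omega>))"
    by (rule integrable_const_bound[where B = "n * B"])
      (auto simp: birkhoff_max_nonneg intro!: birkhoff_max_le B)
  have "0 = integral\<^sup>L P (?M n) - (\<integral>\<omega>. ?M n (\<theta> \<omega>) \<partial>P)"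
    by (simp add: eq)
  also have "\<dots> = (\<integral>\<omega>. ?M n \<omega> - ?M n (\<theta> \<omega>) \<partial>P)"
    using int int' by simp
  also have "\<dots> \<le> (\<integral>\<omega>. h \<omega> * indicator {\<omega>. ?M n \<omega> > 0} \<omega> \<partial>P)"
  proof (rule integral_mono)
    show "integrable P (\<lambda>\<omega>. h \<omega> * indicator {\<omega>. ?M n \<omega> > 0} \<omega>)"
      using B order.trans[OF abs_ge_zero B[of undefined]]
      by (intro integrable_const_bound[where B = B]) (auto simp: abs_mult indicator_def)
    show "?M n \<omega> - ?M n (\<theta> \<omega>) \<le> h \<omega> * indicator {\<omega>. ?M n \<omega> > 0} \<omega>" for \<omega>
    proof (cases "?M n \<omega> > 0")
      case True
      then obtain m where m: "n = Suc m" by (cases n) auto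
      have "?M n \<omega> = h \<omega> + ?M m (\<theta> \<omega>)"
        using True by (auto simp: m max_def split: if_splits)
      also have "\<dots> \<le> h \<omega> + ?M n (\<theta> \<omega>)"
        using birkhoff_max_mono_Suc by (simp add: m del: birkhoff_max.simps)
      finally show ?thesis using True by simp
    next
      case False
      then show ?thesis using birkhoff_max_nonneg[of \<theta> h n "\<theta> \<omega>"] by simp
    qed
  qed (use int int' in simp)
  finally show ?thesis .
qed

text \<open>If the sums were unbounded above almost everywhere, the sets in the maximal inequality
  would exhaust almost all of the space and the integral of \<open>h\<close> would be nonnegative.
  By ergodicity the event of unboundedness is then null.\<close>

lemma birkhoff_sum_bounded_above:
  fixes h :: "'w \<Rightarrow> real"
  assumes erg: "ergodic_system P \<theta>"
    and h [measurable]: "h \<in> borel_measurable P" and B: "\<And>\<omega>. \<bar>h \<omega>\<bar> \<le> B"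
    and neg: "integral\<^sup>L P h < 0"
  shows "AE \<omega> in P. \<exists>K::nat. \<forall>n. (\<Sum>i<n. h ((\<theta> ^^ i) \<omega>)) \<le> real K"
proof -
  have sys: "measure_preserving_system P \<theta>" using erg by (simp add: ergodic_system_def)
  interpret prob_space P using sys by (simp add: measure_preserving_system_def)
  have [measurable]: "\<theta> \<in> measurable P P"
    using sys by (auto simp: measure_preserving_system_def)
  have [measurable]: "(\<theta> ^^ i) \<in> measurable P P" for i
    by (induction i) auto
  let ?S = "\<lambda>n \<omega>. \<Sum>i<n. h ((\<theta> ^^ i) \<omega>)"
  let ?M = "\<lambda>n. birkhoff_max \<theta> h n"
  have [measurable]: "?M n \<in> borel_measurable P" for n
  proof (induction n)
    case (Suc n)
    note this [measurable]
    show ?case by (subst birkhoff_max.simps(2)[abs_def]) measurable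
  qed (simp add: birkhoff_max.simps(1)[abs_def])
  \<comment> \<open>The event that the sums are unbounded above is strictly invariant, as ergodicity requires;
    a condition such as \<open>S\<^sub>n > K\<close> infinitely often would not be.\<close>
  define E where "E = {\<omega> \<in> space P. \<forall>K::nat. \<exists>n. ?S n \<omega> > real K}"
  have E: "E \<in> sets P" unfolding E_def by measurable
  have inv: "(\<forall>K::nat. \<exists>n. ?S n (\<theta> \<omega>) > real K) \<longleftrightarrow> (\<forall>K::nat. \<exists>n. ?S n \<omega> > real K)" for \<omega>
  proof safe
    fix K :: nat
    assume "\<forall>K::nat. \<exists>n. ?S n (\<theta> \<omega>) > real K"
    \<comment> \<open>Passing between \<open>\<omega>\<close> and \<open>\<theta> \<omega>\<close>
      changes a sum by \<open>h \<omega>\<close>, at most \<open>B\<close> in size; raising the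
      threshold by \<open>B\<close> rounded up absorbs this.\<close>
    then obtain n where "?S n (\<theta> \<omega>) > real (K + nat \<lceil>B\<rceil>)" by blast
    then have "?S (Suc n) \<omega> > real K"
      unfolding birkhoff_sum_Suc using B[of \<omega>] by linarith
    then show "\<exists>n. ?S n \<omega> > real K" by blast
  next
    fix K :: nat
    assume "\<forall>K::nat. \<exists>n. ?S n \<omega> > real K"
    then obtain n where n: "?S n \<omega> > real (K + nat \<lceil>B\<rceil>)" by blast
    then obtain m where m: "n = Suc m" by (cases n) auto
    have "?S m (\<theta> \<omega>) > real K"
      using n B[of \<omega>] unfolding m birkhoff_sum_Suc by linarith
    then show "\<exists>n. ?S n (\<theta> \<omega>) > real K" by blast
  qed
  have "\<theta> -` E \<inter> space P = E"
    using inv measurable_space[of \<theta> P P] by (auto simp: E_def)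
  then have "prob E = 0 \<or> prob E = 1"
    using erg E by (auto simp: ergodic_system_def)
  moreover have "prob E \<noteq> 1"
  proof
    assume "prob E = 1"
    then have AE_E: "AE \<omega> in P. \<omega> \<in> E"
      using E by (simp add: prob_eq_1)
    let ?g = "\<lambda>n \<omega>. h \<omega> * indicator {\<omega>. ?M n \<omega> > 0} \<omega>"
    have "(\<lambda>n. integral\<^sup>L P (?g n)) \<longlonglongrightarrow> integral\<^sup>L P h"
    proof (rule integral_dominated_convergence[where w = "\<lambda>_. B"])
      show "AE \<omega> in P. (\<lambda>n. ?g n \<omega>) \<longlonglongrightarrow> h \<omega>"
        using AE_E
      proof eventually_elim
        case (elim \<omega>)
        then obtain m where "?S m \<omega> > real 0" unfolding E_def by blast
        then have pos: "?M m \<omega> > 0"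
          using birkhoff_sum_le_max[where \<theta> = \<theta> and n = m and \<omega> = \<omega> and h = h] by simp
        have "eventually (\<lambda>n. ?g n \<omega> = h \<omega>) sequentially"
          using eventually_ge_at_top[of m]
        proof eventually_elim
          case (elim n)
          then show ?case using pos birkhoff_max_mono[OF elim, of \<theta> h \<omega>] by simp
        qed
        then show ?case by (rule tendsto_eventually)
      qed
      show "AE \<omega> in P. norm (?g n \<omega>) \<le> B" for n
        using B order.trans[OF abs_ge_zero B[of undefined]]
        by (auto simp: abs_mult indicator_def)
    qed auto
    then have "integral\<^sup>L P h \<ge> 0"
      by (rule LIMSEQ_le_const)
        (use maximal_ergodic_inequality[OF sys h B] in auto)
    with neg show False by simp
  qed
  ultimately have "AE \<omega> in P. \<omega> \<notin> E"
    using E by (auto simp: prob_eq_0)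
  then show ?thesis
    using AE_space by eventually_elim (auto simp: E_def not_less)
qed

text \<open>Subtracting slightly more than the mean makes the integral negative, so the centred sums
  are bounded above, and the bound vanishes after division by \<open>n\<close>. The countably many
  margins \<open>1 / Suc k\<close> give one null set for all \<open>e\<close>.\<close>

lemma birkhoff_limsup_le:
  fixes g :: "'w \<Rightarrow> real"
  assumes erg: "ergodic_system P \<theta>"
    and g [measurable]: "g \<in> borel_measurable P" and B: "\<And>\<omega>. \<bar>g \<omega>\<bar> \<le> B"
  shows "AE \<omega> in P. \<forall>e>0. eventually (\<lambda>n. (\<Sum>i<n. g ((\<theta> ^^ i) \<omega>)) / n < integral\<^sup>L P g + e) sequentially"
proof -
  interpret prob_space P
    using erg by (simp add: ergodic_system_def measure_preserving_system_def)
  have "AE \<omega> in P. \<exists>K::nat. \<forall>n. (\<Sum>i<n. g ((\<theta> ^^ i) \<omega>) - (integral\<^sup>L P g + 1 / Suc k)) \<le> real K" for k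
  proof (rule birkhoff_sum_bounded_above[OF erg])
    have "integrable P g"
      using B by (intro integrable_const_bound[where B = B]) auto
    then show "(\<integral>\<omega>. g \<omega> - (integral\<^sup>L P g + 1 / Suc k) \<partial>P) < 0"
      by (simp add: prob_space)
    show "\<bar>g \<omega> - (integral\<^sup>L P g + 1 / Suc k)\<bar> \<le> B + \<bar>integral\<^sup>L P g + 1 / Suc k\<bar>" for \<omega>
      using B[of \<omega>] by linarith
  qed simp
  then have "AE \<omega> in P. \<forall>k. \<exists>K::nat. \<forall>n. (\<Sum>i<n. g ((\<theta> ^^ i) \<omega>) - (integral\<^sup>L P g + 1 / Suc k)) \<le> real K"
    by (subst AE_all_countable) blast
  then show ?thesis
  proof eventually_elim
    case (elim \<omega>)
    show ?case
    proof (intro allI impI)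
      fix e :: real assume "e > 0"
      then obtain k where k: "1 / Suc k < e / 2"
        using reals_Archimedean[of "e / 2"] by (auto simp: inverse_eq_divide)
      obtain K :: nat where K: "(\<Sum>i<n. g ((\<theta> ^^ i) \<omega>) - (integral\<^sup>L P g + 1 / Suc k)) \<le> real K" for n
        using elim by blast
      have "eventually (\<lambda>n. K / real n < e / 2) sequentially"
        using \<open>e > 0\<close> by (intro order_tendstoD(2)[OF lim_const_over_n]) auto
      then show "eventually (\<lambda>n. (\<Sum>i<n. g ((\<theta> ^^ i) \<omega>)) / n < integral\<^sup>L P g + e) sequentially"
        using eventually_gt_at_top[of 0]
      proof eventually_elim
        case (elim n)
        have "(\<Sum>i<n. g ((\<theta> ^^ i) \<omega>)) \<le> K + n * (integral\<^sup>L P g + 1 / Suc k)"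
          using K[of n] by (simp add: sum_subtractf)
        then have "(\<Sum>i<n. g ((\<theta> ^^ i) \<omega>)) / n \<le> (K + n * (integral\<^sup>L P g + 1 / Suc k)) / n"
          by (rule divide_right_mono) simp
        also have "\<dots> = K / n + (integral\<^sup>L P g + 1 / Suc k)"
          using elim by (simp add: add_divide_distrib[of "real K"])
        finally have "(\<Sum>i<n. g ((\<theta> ^^ i) \<omega>)) / n \<le> K / n + (integral\<^sup>L P g + 1 / Suc k)" .
        then show ?case using elim k by linarith
      qed
    qed
  qed
qed

text \<open>The upper bounds for \<open>g\<close> and for \<open>- g\<close> enclose the
  averages.\<close>

lemma birkhoff_ergodic:
  fixes g :: "'w \<Rightarrow> real"
  assumes erg: "ergodic_system P \<theta>"
    and g [measurable]: "g \<in> borel_measurable P" and B: "\<And>\<omega>. \<bar>g \<omega>\<bar> \<le> B"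
  shows "AE \<omega> in P. (\<lambda>n. (\<Sum>i<n. g ((\<theta> ^^ i) \<omega>)) / n) \<longlonglongrightarrow> integral\<^sup>L P g"
proof -
  have "AE \<omega> in P. \<forall>e>0. eventually (\<lambda>n. (\<Sum>i<n. - g ((\<theta> ^^ i) \<omega>)) / n < (\<integral>\<omega>. - g \<omega> \<partial>P) + e) sequentially"
    using B by (intro birkhoff_limsup_le[OF erg, where B = B]) auto
  with birkhoff_limsup_le[OF erg g B] show ?thesis
  proof eventually_elim
    case (elim \<omega>)
    show ?case
    proof (rule tendstoI)
      fix e :: real assume "e > 0"
      with elim have "eventually (\<lambda>n. (\<Sum>i<n. g ((\<theta> ^^ i) \<omega>)) / n < integral\<^sup>L P g + e) sequentially"
        "eventually (\<lambda>n. (\<Sum>i<n. - g ((\<theta> ^^ i) \<omega>)) / n < (\<integral>\<omega>. - g \<omega> \<partial>P) + e) sequentially"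
        by blast+
      then show "eventually (\<lambda>n. dist ((\<Sum>i<n. g ((\<theta> ^^ i) \<omega>)) / n) (integral\<^sup>L P g) < e) sequentially"
        by eventually_elim (auto simp: dist_real_def sum_negf)
    qed
  qed
qed

subsection \<open>Ultrafilters\<close>

definition ultrafilter :: "'a filter \<Rightarrow> bool" where
  "ultrafilter u \<longleftrightarrow> u \<noteq> bot \<and> (\<forall>P. eventually P u \<or> eventually (\<lambda>x. \<not> P x) u)"

lemma ultrafilter_not_bot: "ultrafilter u \<Longrightarrow> u \<noteq> bot"
  by (simp add: ultrafilter_def)

lemma ultrafilter_not:
  assumes "ultrafilter u"
  shows "eventually (\<lambda>x. \<not> P x) u \<longleftrightarrow> \<not> eventually P u"
proof -
  have "\<not> (eventually P u \<and> eventually (\<lambda>x. \<not> P x) u)"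
    using assms by (auto simp: ultrafilter_def dest: eventually_conj)
  then show ?thesis
    using assms by (auto simp: ultrafilter_def)
qed

lemma ultrafilter_disj:
  assumes "ultrafilter u"
  shows "eventually (\<lambda>x. P x \<or> Q x) u \<longleftrightarrow> eventually P u \<or> eventually Q u"
  using ultrafilter_not[OF assms, of "\<lambda>x. P x \<or> Q x"] ultrafilter_not[OF assms, of P]
    ultrafilter_not[OF assms, of Q]
  by (simp add: eventually_conj_iff) blast

lemma ultrafilter_filtermap: "ultrafilter u \<Longrightarrow> ultrafilter (filtermap g u)"
  by (auto simp: ultrafilter_def eventually_filtermap filtermap_bot_iff)

text \<open>Smaller filters are finer, so Zorn's lemma is used downwards. A minimal proper filter
  decides every predicate: adding the predicate either destroys properness or changes
  nothing.\<close>

lemma ultrafilter_exists: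
  fixes F :: "'a filter"
  assumes "F \<noteq> bot"
  obtains u where "ultrafilter u" "u \<le> F"
proof -
  define A where "A = {G. G \<noteq> bot \<and> G \<le> F}"
  have "\<exists>m\<in>A. \<forall>a\<in>A. m \<ge> a \<longrightarrow> a = m"
  proof (rule predicate_Zorn)
    show "partial_order_on A (relation_of (\<ge>) A)"
      by (rule partial_order_on_relation_ofI) auto
  next
    fix C assume C: "C \<in> Chains (relation_of (\<ge>) A)"
    have CA: "C \<subseteq> A"
      using C by (auto simp: Chains_def relation_of_def)
    show "\<exists>u\<in>A. \<forall>a\<in>C. a \<ge> u"
    proof (cases "C = {}")
      case True
      then show ?thesis
        using assms by (auto simp: A_def)
    next
      case False
      \<comment> \<open>A chain is directed, so whatever holds eventually for its infimum already
        does for a member; hence the infimum stays proper.\<close>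
      have "eventually P (Inf C) \<longleftrightarrow> (\<exists>b\<in>C. eventually P b)" for P
      proof (rule eventually_Inf_base[OF False])
        fix F G assume "F \<in> C" "G \<in> C"
        then have "F \<le> G \<or> G \<le> F"
          using C by (auto simp: Chains_def relation_of_def)
        then show "\<exists>x\<in>C. x \<le> inf F G"
          using \<open>F \<in> C\<close> \<open>G \<in> C\<close> by auto
      qed
      from this[of "\<lambda>_. False"] have "Inf C \<noteq> bot"
        using CA by (auto simp: A_def trivial_limit_def)
      moreover have "Inf C \<le> F"
        using False CA by (auto simp: A_def intro: Inf_lower2)
      ultimately show ?thesis
        by (intro bexI[of _ "Inf C"]) (auto simp: A_def intro: Inf_lower)
    qed
  qed
  then obtain m where m: "m \<noteq> bot" "m \<le> F" "\<And>a. a \<noteq> bot \<Longrightarrow> a \<le> m \<Longrightarrow> a = m"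
    by (auto simp: A_def)
  have "eventually P m \<or> eventually (\<lambda>x. \<not> P x) m" for P
  proof (cases "inf m (principal {x. P x}) = bot")
    case True
    then have "eventually (\<lambda>x. P x \<longrightarrow> False) m"
      by (simp add: trivial_limit_def eventually_inf_principal)
    then show ?thesis by simp
  next
    case False
    then have "inf m (principal {x. P x}) = m"
      by (intro m) auto
    then have "m \<le> principal {x. P x}"
      by (metis inf.cobounded2)
    then show ?thesis
      by (simp add: le_principal)
  qed
  with m(1,2) show thesis
    by (intro that[of m]) (auto simp: ultrafilter_def)
qed

text \<open>Compactness gives a cluster point, and an ultrafilter converges to each of its cluster
  points: a neighbourhood not eventually entered would be eventually avoided.\<close>

lemma ultrafilter_limit_exists:
  assumes u: "ultrafilter u" and S: "compact S" and ev: "eventually (\<lambda>i. z i \<in> S) u"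
  obtains l where "l \<in> S" "(z \<longlongrightarrow> l) u"
proof -
  have "filtermap z u \<noteq> bot" "eventually (\<lambda>x. x \<in> S) (filtermap z u)"
    using u ev by (auto simp: ultrafilter_def filtermap_bot_iff eventually_filtermap)
  then obtain l where l: "l \<in> S" "inf (nhds l) (filtermap z u) \<noteq> bot"
    using S by (auto simp: compact_filter)
  have "eventually (\<lambda>i. z i \<in> T) u" if "open T" "l \<in> T" for T
  proof (rule ccontr)
    assume "\<not> eventually (\<lambda>i. z i \<in> T) u"
    then have "eventually (\<lambda>x. x \<notin> T) (filtermap z u)"
      using ultrafilter_not[OF u] by (simp add: eventually_filtermap)
    moreover have "eventually (\<lambda>x. x \<in> T) (nhds l)"
      using that by (rule eventually_nhds_in_open)
    ultimately have "eventually (\<lambda>x. False) (inf (nhds l) (filtermap z u))"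
      unfolding eventually_inf by blast
    with l show False
      by (simp add: trivial_limit_def)
  qed
  with l show thesis
    by (intro that[of l]) (auto intro: topological_tendstoI)
qed

lemma tendsto_ultrafilter_Lim:
  fixes z :: "'i \<Rightarrow> 'a::t2_space"
  assumes "ultrafilter u" "compact (UNIV :: 'a set)"
  shows "(z \<longlongrightarrow> Lim u z) u"
proof -
  obtain l where "(z \<longlongrightarrow> l) u"
    using ultrafilter_limit_exists[OF assms, of z] by auto
  with ultrafilter_not_bot[OF assms(1)] show ?thesis
    by (metis tendsto_Lim)
qed

section \<open>The Stone space of ultrafilters and its algebra of clopen sets\<close>

definition ultrafilters :: "'i filter set" where
  "ultrafilters = {u. ultrafilter u}"

text \<open>The basic clopen sets of the Stone-Cech compactification of a discrete set. No topology
  is introduced; its compactness enters through \<open>clopen_decseq_Inter_empty\<close>.\<close>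

definition clopen :: "'i set \<Rightarrow> 'i filter set" where
  "clopen A = {u. ultrafilter u \<and> eventually (\<lambda>i. i \<in> A) u}"

lemma clopen_subset: "clopen A \<subseteq> ultrafilters"
  by (auto simp: clopen_def ultrafilters_def)

lemma clopen_empty [simp]: "clopen {} = {}"
  by (auto simp: clopen_def ultrafilter_def)

lemma clopen_UNIV [simp]: "clopen UNIV = ultrafilters"
  by (auto simp: clopen_def ultrafilters_def)

lemma clopen_Un: "clopen A \<union> clopen B = clopen (A \<union> B)"
  by (auto simp: clopen_def ultrafilter_disj)

lemma clopen_Int: "clopen A \<inter> clopen B = clopen (A \<inter> B)"
  by (auto simp: clopen_def eventually_conj_iff)

lemma clopen_Diff: "clopen A - clopen B = clopen (A - B)"
  by (auto simp: clopen_def eventually_conj_iff ultrafilter_not)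

lemma clopen_mono: "A \<subseteq> B \<Longrightarrow> clopen A \<subseteq> clopen B"
  by (auto simp: clopen_def elim: eventually_mono)

text \<open>Indices embed as principal ultrafilters, so \<open>clopen\<close> is injective.\<close>

lemma principal_in_clopen [simp]: "principal {i} \<in> clopen A \<longleftrightarrow> i \<in> A"
  by (auto simp: clopen_def ultrafilter_def eventually_principal principal_eq_bot_iff)

lemma algebra_clopen: "algebra ultrafilters (range clopen)"
  unfolding algebra_iff_Un
  by (auto simp: clopen_Un simp flip: clopen_UNIV simp: clopen_Diff intro!: range_eqI[of _ clopen "{}"]
     dest: subsetD[OF clopen_subset])

text \<open>Compactness for sequences: if all \<open>A k\<close> were nonempty, they would generate
  a proper filter, and an ultrafilter refining it would lie in every
  \<open>clopen (A k)\<close>.\<close>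

lemma clopen_decseq_Inter_empty:
  assumes dec: "decseq A" and empty: "(\<Inter>k. clopen (A k)) = {}"
  obtains k where "A k = {}"
proof (rule ccontr)
  assume "\<not> thesis"
  then have nonempty: "A k \<noteq> {}" for k
    using that by blast
  have ev: "eventually P (INF k. principal (A k)) \<longleftrightarrow> (\<exists>b\<in>range (\<lambda>k. principal (A k)). eventually P b)" for P
  proof (rule eventually_Inf_base)
    fix F G assume "F \<in> range (\<lambda>k. principal (A k))" "G \<in> range (\<lambda>k. principal (A k))"
    then obtain i j where "F = principal (A i)" "G = principal (A j)" by blast
    then have "principal (A (max i j)) \<le> inf F G"
      using decseqD[OF dec, of i "max i j"] decseqD[OF dec, of j "max i j"] by auto
    then show "\<exists>x\<in>range (\<lambda>k. principal (A k)). x \<le> inf F G" by blast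
  qed auto
  have "(INF k. principal (A k)) \<noteq> bot"
    using ev[of "\<lambda>_. False"] nonempty by (auto simp: trivial_limit_def eventually_principal)
  then obtain u where u: "ultrafilter u" "u \<le> (INF k. principal (A k))"
    by (rule ultrafilter_exists)
  have "u \<in> clopen (A k)" for k
  proof -
    have "u \<le> principal (A k)"
      using u(2) by (rule order.trans) (auto intro: INF_lower)
    then show ?thesis using u(1) by (simp add: clopen_def le_principal)
  qed
  with empty show False by blast
qed

subsection \<open>The measure of limit frequencies\<close>

text \<open>At \<open>n = 0\<close> the division yields 0, so the bounds and additivity need no side
  condition.\<close>

definition frequency :: "nat set \<Rightarrow> nat \<Rightarrow> real" where
  "frequency A n = card (A \<inter> {..<n}) / n"

lemma frequency_bounds: "0 \<le> frequency A n" "frequency A n \<le> 1"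
proof -
  have "card (A \<inter> {..<n}) \<le> card {..<n}" by (intro card_mono) auto
  then show "frequency A n \<le> 1" by (auto simp: frequency_def divide_le_eq)
qed (simp add: frequency_def)

lemma frequency_Un: "A \<inter> B = {} \<Longrightarrow> frequency (A \<union> B) n = frequency A n + frequency B n"
  by (subst frequency_def, subst Int_Un_distrib2, subst card_Un_disjoint)
    (auto simp: frequency_def add_divide_distrib)

text \<open>For an orbit \<open>z\<close> this turns visit frequencies into Birkhoff averages of an
  indicator.\<close>

lemma frequency_eq_sum: "frequency {i. z i \<in> S} n = (\<Sum>i<n. indicator S (z i)) / n"
  by (auto simp: frequency_def indicator_def Collect_conj_eq[symmetric] sum.If_cases intro!: arg_cong[of _ _ card])

text \<open>The difference telescopes to two boundary terms.\<close>

lemma frequency_shift_diff: "\<bar>frequency {i. Suc i \<in> A} n - frequency A n\<bar> \<le> 1 / n"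
proof -
  have 1: "frequency A n = (\<Sum>i<n. indicator A i) / n" for A
    using frequency_eq_sum[of "\<lambda>i. i" A] by simp
  have "frequency {i. Suc i \<in> A} n - frequency A n = ((\<Sum>i<n. indicator A (Suc i)) - (\<Sum>i<n. indicator A i)) / n"
    unfolding frequency_eq_sum 1[of A] by (simp add: diff_divide_distrib)
  also have "(\<Sum>i<n. indicator A (Suc i)) - (\<Sum>i<n. indicator A i) = (indicator A n - indicator A 0 :: real)"
    by (induction n) auto
  finally show ?thesis
    by (auto simp: indicator_def)
qed

text \<open>Limits along \<open>V\<close> exist for every set of indices because frequencies lie in
  a compact interval. Additivity passes to the limit, and a decreasing sequence of clopen sets with
  empty intersection is eventually empty, so Caratheodory's extension applies. That \<open>V\<close>
  refines the tail filter gives total mass 1 and shift invariance.\<close>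

lemma frequency_measure_exists:
  assumes V: "ultrafilter V" "V \<le> sequentially"
  obtains M where "prob_space M" "space M = ultrafilters"
    "sets M = sigma_sets ultrafilters (range clopen)"
    "\<And>A. (frequency A \<longlongrightarrow> measure M (clopen A)) V"
    "filtermap Suc \<in> measurable M M" "distr M M (filtermap Suc) = M"
proof -
  interpret algebra "ultrafilters :: nat filter set" "range clopen"
    by (rule algebra_clopen)
  have nb: "V \<noteq> bot" using V by (simp add: ultrafilter_not_bot)
  define m where "m A = Lim V (frequency A)" for A
  have m: "(frequency A \<longlongrightarrow> m A) V" for A
  proof -
    obtain l where "(frequency A \<longlongrightarrow> l) V"
      using frequency_bounds by (auto intro: ultrafilter_limit_exists[OF V(1), of "{0..1::real}" "frequency A"])
    then show ?thesis
      using tendsto_Lim[OF nb, of "frequency A" l] by (simp add: m_def)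
  qed
  have m_nonneg: "m A \<ge> 0" for A
    by (rule tendsto_lowerbound[OF m _ nb]) (simp add: frequency_bounds)
  have m_empty: "m {} = 0"
    by (rule tendsto_unique[OF nb m]) (simp add: frequency_def[abs_def])
  have m_UNIV: "m UNIV = 1"
  proof (rule tendsto_unique[OF nb m])
    have "eventually (\<lambda>n. frequency UNIV n = 1) V"
      using eventually_gt_at_top[of 0] V(2) unfolding le_filter_def
      by (auto simp: frequency_def elim!: allE eventually_mono)
    then show "(frequency UNIV \<longlongrightarrow> 1) V" by (rule tendsto_eventually)
  qed
  have m_Un: "m (A \<union> B) = m A + m B" if "A \<inter> B = {}" for A B
  proof (rule tendsto_unique[OF nb m])
    have "frequency (A \<union> B) = (\<lambda>n. frequency A n + frequency B n)"
      by (rule ext) (rule frequency_Un[OF that])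
    then show "(frequency (A \<union> B) \<longlongrightarrow> m A + m B) V"
      by (simp only: tendsto_add[OF m[of A] m[of B]])
  qed
  have m_shift: "m {i. Suc i \<in> A} = m A" for A
  proof -
    have "((\<lambda>n. 1 / real n) \<longlongrightarrow> 0) V"
      using V(2) lim_const_over_n[of 1] by (rule tendsto_mono)
    then have "((\<lambda>n. frequency {i. Suc i \<in> A} n - frequency A n) \<longlongrightarrow> 0) V"
      by (rule Lim_null_comparison[rotated]) (simp add: frequency_shift_diff)
    then have "((\<lambda>n. (frequency {i. Suc i \<in> A} n - frequency A n) + frequency A n) \<longlongrightarrow> 0 + m A) V"
      by (rule tendsto_add[OF _ m])
    then show ?thesis
      using m by (auto intro: tendsto_unique[OF nb])
  qed
  \<comment> \<open>The principal ultrafilters in a clopen set recover the set of indices.\<close>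
  define \<mu>0 where "\<mu>0 C = ennreal (m {i. principal {i} \<in> C})" for C
  have \<mu>0: "\<mu>0 (clopen A) = ennreal (m A)" for A
    by (simp add: \<mu>0_def)
  have "\<exists>\<mu>. (\<forall>s\<in>range clopen. \<mu> s = \<mu>0 s) \<and> measure_space ultrafilters (sigma_sets ultrafilters (range clopen)) \<mu>"
  proof (rule caratheodory_empty_continuous)
    show "positive (range clopen) \<mu>0"
      using \<mu>0[of "{}"] by (simp add: positive_def m_empty)
    show "additive (range clopen) \<mu>0"
    proof (clarsimp simp: additive_def)
      fix A B :: "nat set" assume "clopen A \<inter> clopen B = {}"
      then have "A \<inter> B = {}"
        by (metis clopen_Int disjoint_iff principal_in_clopen)
      then show "\<mu>0 (clopen A \<union> clopen B) = \<mu>0 (clopen A) + \<mu>0 (clopen B)"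
        by (simp add: clopen_Un \<mu>0 m_Un m_nonneg)
    qed
    show "\<mu>0 A \<noteq> \<infinity>" for A by (simp add: \<mu>0_def)
    fix C :: "nat \<Rightarrow> nat filter set"
    assume C: "range C \<subseteq> range clopen" "decseq C" "(\<Inter>i. C i) = {}"
    define A where "A k = {i. principal {i} \<in> C k}" for k
    have CA: "C k = clopen (A k)" for k
    proof -
      obtain A' where "C k = clopen A'" using C(1) by blast
      then show ?thesis by (simp add: A_def)
    qed
    have decA: "decseq A"
      using C(2) by (auto simp: decseq_def A_def)
    obtain k where k: "A k = {}"
      using clopen_decseq_Inter_empty[OF decA] C(3) by (auto simp only: CA)
    have "eventually (\<lambda>j. \<mu>0 (C j) = 0) sequentially"
      using eventually_ge_at_top[of k]
    proof eventually_elim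
      case (elim j)
      then have "A j = {}" using decseqD[OF decA elim] k by blast
      then show ?case by (simp add: CA \<mu>0[of "{}", simplified] m_empty)
    qed
    then show "(\<lambda>i. \<mu>0 (C i)) \<longlonglongrightarrow> 0" by (rule tendsto_eventually)
  qed
  then obtain \<mu> where \<mu>: "\<And>A. \<mu> (clopen A) = ennreal (m A)"
    "measure_space ultrafilters (sigma_sets ultrafilters (range clopen)) \<mu>"
    using \<mu>0 by auto
  define M where "M = measure_of ultrafilters (range clopen) \<mu>"
  have sub: "range clopen \<subseteq> Pow (ultrafilters :: nat filter set)"
    using clopen_subset by blast
  have space: "space M = ultrafilters"
    unfolding M_def using sub by (rule space_measure_of)
  have sets: "sets M = sigma_sets ultrafilters (range clopen)"
    unfolding M_def using sub by (rule sets_measure_of)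
  have clopen: "clopen A \<in> sets M" for A
    unfolding sets by (auto intro: sigma_sets.Basic)
  have em: "emeasure M (clopen A) = ennreal (m A)" for A
    using \<mu>(2) clopen[of A] unfolding M_def
    by (subst emeasure_measure_of[OF refl sub]) (auto simp: measure_space_def \<mu> M_def sets sets_measure_of[OF sub])
  interpret M: prob_space M
    by (rule prob_spaceI) (simp add: space m_UNIV em[of UNIV, simplified])
  have meas: "measure M (clopen A) = m A" for A
    by (simp add: measure_def em m_nonneg)
  \<comment> \<open>Pushing forward by \<open>Suc\<close> extends the shift to ultrafilters; on
    clopen sets it is the shift of index sets, so \<open>m_shift\<close> settles invariance on a
    generator.\<close>
  have vim: "filtermap Suc -` clopen A \<inter> ultrafilters = clopen {i. Suc i \<in> A}" for A
    by (auto simp: clopen_def ultrafilters_def eventually_filtermap ultrafilter_filtermap)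
  have shift: "filtermap Suc \<in> measurable M M"
    using sub by (subst (2) M_def, intro measurable_measure_of)
      (auto simp: space vim clopen, auto simp: ultrafilters_def ultrafilter_filtermap)
  have "M = distr M M (filtermap Suc)"
  proof (rule measure_eqI_generator_eq[where E = "range clopen" and \<Omega> = ultrafilters and A = "\<lambda>_. ultrafilters"])
    show "Int_stable (range clopen :: nat filter set set)"
      by (auto simp: Int_stable_def clopen_Int)
    show "emeasure M X = emeasure (distr M M (filtermap Suc)) X" if "X \<in> range clopen" for X
    proof -
      from that obtain A where X: "X = clopen A" by blast
      show ?thesis
        by (simp add: X emeasure_distr[OF shift] clopen space vim em m_shift)
    qed
    show "range (\<lambda>_. ultrafilters) \<subseteq> range clopen"
      by (auto intro!: range_eqI[of _ clopen UNIV])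
  qed (auto simp: sets clopen_subset dest: subsetD[OF clopen_subset])
  then show thesis
    using that[OF M.prob_space_axioms space sets] m shift by (simp add: meas)
qed

subsection \<open>Compact metric spaces and limits along ultrafilters\<close>

text \<open>Total boundedness gives finite covers by balls of radius \<open>1 / Suc n\<close>; the
  balls of all these covers form a basis.\<close>

lemma compact_metric_countable_basis:
  assumes "compact (UNIV :: 'a::metric_space set)"
  obtains B :: "'a::metric_space set set" where "countable B" "topological_basis B"
proof -
  have "\<exists>k. finite k \<and> (UNIV :: 'a set) \<subseteq> (\<Union>x\<in>k. ball x e)" if "e > 0" for e
    using seq_compact_imp_totally_bounded[OF compact_imp_seq_compact[OF assms]] that by blast
  then have "\<forall>n::nat. \<exists>k. finite k \<and> (UNIV :: 'a set) \<subseteq> (\<Union>x\<in>k. ball x (1 / Suc n))"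
    by simp
  then obtain K :: "nat \<Rightarrow> 'a set" where
    K: "\<And>n. finite (K n)" "\<And>n. UNIV \<subseteq> (\<Union>x\<in>K n. ball x (1 / Suc n))"
    by metis
  define B where "B = (\<Union>n. (\<lambda>x. ball x (1 / Suc n)) ` K n)"
  have "countable B"
    unfolding B_def using K(1) by (intro countable_UN) (auto intro: countable_finite)
  moreover have "topological_basis B"
  proof (rule topological_basisI)
    show "open T" if "T \<in> B" for T using that by (auto simp: B_def)
    fix O' :: "'a set" and x assume "open O'" "x \<in> O'"
    then obtain e where e: "e > 0" "ball x e \<subseteq> O'" by (auto simp: open_contains_ball)
    then obtain n where n: "1 / Suc n < e / 2"
      using reals_Archimedean[of "e / 2"] by (auto simp: inverse_eq_divide)
    obtain c where c: "c \<in> K n" "x \<in> ball c (1 / Suc n)" using K(2)[of n] by blast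
    have "ball c (1 / Suc n) \<subseteq> ball x e"
    proof
      fix y assume "y \<in> ball c (1 / Suc n)"
      then show "y \<in> ball x e"
        using c(2) n dist_triangle[of x y c] by (simp add: dist_commute)
    qed
    with c e show "\<exists>B'\<in>B. x \<in> B' \<and> B' \<subseteq> O'"
      by (intro bexI[of _ "ball c (1 / Suc n)"]) (auto simp: B_def)
  qed
  ultimately show thesis by (rule that)
qed

text \<open>Closing a countable basis under finite intersections makes it a generator on which
  measures can be compared; \<open>UNIV\<close> is the empty intersection.\<close>

lemma compact_metric_Int_stable_basis:
  assumes "compact (UNIV :: 'a::metric_space set)"
  obtains B :: "'a::metric_space set set" where "countable B" "topological_basis B" "Int_stable B" "UNIV \<in> B"
proof -
  obtain B0 :: "'a set set" where B0: "countable B0" "topological_basis B0"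
    using compact_metric_countable_basis[OF assms] .
  define B where "B = Inter ` {F. finite F \<and> F \<subseteq> B0}"
  have "countable B"
    unfolding B_def using B0(1) by (intro countable_image countable_Collect_finite_subset)
  moreover have "topological_basis B"
    unfolding topological_basis_def
  proof safe
    show "open S" if "S \<in> B" for S
      using that B0(2) by (auto simp: B_def topological_basis_open intro!: open_Inter)
    fix S :: "'a set" assume "open S"
    then obtain B' where "B' \<subseteq> B0" "\<Union>B' = S"
      using B0(2) by (meson topological_basis_def)
    moreover have "B0 \<subseteq> B"
    proof
      fix b assume "b \<in> B0"
      then show "b \<in> B" by (auto simp: B_def intro!: image_eqI[of _ _ "{b}"])
    qed
    ultimately show "\<exists>B'\<subseteq>B. \<Union>B' = S" by blast
  qed
  moreover have "Int_stable B"
    unfolding B_def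
  proof (rule Int_stableI_image)
    fix F G assume "F \<in> {F. finite F \<and> F \<subseteq> B0}" "G \<in> {F. finite F \<and> F \<subseteq> B0}"
    then show "\<exists>H\<in>{F. finite F \<and> F \<subseteq> B0}. \<Inter>F \<inter> \<Inter>G = \<Inter>H"
      by (intro bexI[of _ "F \<union> G"]) auto
  qed
  moreover have "UNIV \<in> B"
    by (auto simp: B_def intro!: image_eqI[of _ _ "{}"])
  ultimately show thesis by (rule that)
qed

text \<open>The points at distance at least \<open>1 / Suc n\<close> from the complement, phrased by
  balls so that \<open>U = UNIV\<close> is no exception. These sets leave room for passing to
  limits.\<close>

definition inner_part :: "'a::metric_space set \<Rightarrow> nat \<Rightarrow> 'a set" where
  "inner_part U n = {y. ball y (1 / Suc n) \<subseteq> U}"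

lemma inner_part_borel [measurable]: "inner_part U n \<in> sets borel"
proof -
  have "- inner_part U n = (\<Union>w\<in>-U. ball w (1 / Suc n))"
    by (auto simp: inner_part_def dist_commute)
  then have "open (- inner_part U n)" by auto
  then show ?thesis by (simp add: borel_closed closed_def)
qed

lemma incseq_inner_part: "incseq (inner_part U)"
proof (rule incseq_SucI, rule subsetI)
  fix n y assume "y \<in> inner_part U n"
  moreover have "ball y (1 / Suc (Suc n)) \<subseteq> ball y (1 / Suc n)"
    by (intro subset_ball) (simp add: frac_le)
  ultimately show "y \<in> inner_part U (Suc n)" by (auto simp: inner_part_def)
qed

lemma eventually_in_inner_part:
  assumes "open U" "y \<in> U"
  obtains n where "eventually (\<lambda>y. y \<in> inner_part U n) (nhds y)"
proof -
  obtain e where e: "e > 0" "ball y e \<subseteq> U"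
    using assms by (auto simp: open_contains_ball)
  then obtain n where n: "1 / Suc n < e / 2"
    using reals_Archimedean[of "e / 2"] by (auto simp: inverse_eq_divide)
  \<comment> \<open>Half of \<open>e\<close> pays for moving from \<open>y\<close> to
    \<open>w\<close>, the other half for the ball around \<open>w\<close>.\<close>
  have "w \<in> inner_part U n" if "dist w y < e / 2" for w
  proof -
    have "ball w (1 / Suc n) \<subseteq> ball y e"
    proof
      fix v assume "v \<in> ball w (1 / Suc n)"
      then show "v \<in> ball y e"
        using that n dist_triangle[of y v w] by (simp add: dist_commute)
    qed
    with e show ?thesis by (auto simp: inner_part_def)
  qed
  then have "eventually (\<lambda>y. y \<in> inner_part U n) (nhds y)"
    using e by (auto simp: eventually_nhds_metric intro!: exI[of _ "e / 2"])
  then show thesis by (rule that)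
qed

lemma UN_inner_part: "open U \<Longrightarrow> (\<Union>n. inner_part U n) = U"
proof (intro equalityI subsetI)
  fix y assume "open U" "y \<in> U"
  then show "y \<in> (\<Union>n. inner_part U n)"
    by (metis UN_I UNIV_I eventually_in_inner_part eventually_nhds_x_imp_x)
next
  fix y assume "y \<in> (\<Union>n. inner_part U n)"
  then obtain n where "ball y (1 / Suc n) \<subseteq> U" by (auto simp: inner_part_def)
  moreover have "y \<in> ball y (1 / Suc n)" by simp
  ultimately show "y \<in> U" by blast
qed

text \<open>A limit in \<open>U\<close> has a neighbourhood inside some inner part, which
  \<open>z\<close> eventually enters. Conversely, if \<open>z i\<close> lies in
  \<open>inner_part U n\<close> and within \<open>1 / Suc n\<close> of the limit, then the limit
  lies in \<open>U\<close>.\<close>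

lemma Lim_vimage_open:
  fixes z :: "nat \<Rightarrow> 'a::metric_space"
  assumes compact: "compact (UNIV :: 'a set)" and U: "open U"
  shows "(\<lambda>u. Lim u z) -` U \<inter> ultrafilters = (\<Union>n. clopen {i. z i \<in> inner_part U n})"
proof (intro equalityI subsetI)
  fix u assume "u \<in> (\<lambda>u. Lim u z) -` U \<inter> ultrafilters"
  then have u: "ultrafilter u" "Lim u z \<in> U" by (auto simp: ultrafilters_def)
  obtain n where n: "eventually (\<lambda>y. y \<in> inner_part U n) (nhds (Lim u z))"
    using eventually_in_inner_part[OF U u(2)] .
  have "eventually (\<lambda>i. z i \<in> inner_part U n) u"
    using n tendsto_ultrafilter_Lim[OF u(1) compact, of z] by (rule eventually_compose_filterlim)
  then show "u \<in> (\<Union>n. clopen {i. z i \<in> inner_part U n})"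
    using u by (auto simp: clopen_def)
next
  fix u assume "u \<in> (\<Union>n. clopen {i. z i \<in> inner_part U n})"
  then obtain n where u: "ultrafilter u" "eventually (\<lambda>i. z i \<in> inner_part U n) u"
    by (auto simp: clopen_def)
  have "eventually (\<lambda>i. dist (z i) (Lim u z) < 1 / Suc n) u"
    using tendsto_ultrafilter_Lim[OF u(1) compact, of z] by (rule tendstoD) simp
  \<comment> \<open>The statement does not depend on \<open>i\<close>, so it is simply true, the
    filter being proper.\<close>
  with u(2) have "eventually (\<lambda>i. Lim u z \<in> U) u"
    by eventually_elim (auto simp: inner_part_def)
  then show "u \<in> (\<lambda>u. Lim u z) -` U \<inter> ultrafilters"
    using u(1) by (auto simp: ultrafilters_def ultrafilter_def eventually_const_iff)
qed

lemma Lim_measurable: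
  fixes z :: "nat \<Rightarrow> 'a::metric_space"
  assumes compact: "compact (UNIV :: 'a set)"
    and M: "space M = ultrafilters" "sets M = sigma_sets ultrafilters (range clopen)"
  shows "(\<lambda>u. Lim u z) \<in> borel_measurable M"
proof (rule borel_measurableI)
  fix U :: "'a set" assume "open U"
  then show "(\<lambda>u. Lim u z) -` U \<inter> space M \<in> sets M"
    unfolding M(1) Lim_vimage_open[OF compact \<open>open U\<close>]
    by (intro sets.countable_UN) (auto simp: M(2) intro: sigma_sets.Basic)
qed

text \<open>Both measures of a basic \<open>U\<close> are limits over its inner parts, where they
  agree. Frequencies of visits to \<open>U\<close> itself could count indices along which
  \<open>z\<close> tends to the boundary.\<close>

lemma distr_Lim_eq:
  fixes P :: "'a::metric_space measure" and z :: "nat \<Rightarrow> 'a"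
  assumes compact: "compact (UNIV :: 'a set)"
    and P: "prob_space P" "sets P = sets borel"
    and M: "prob_space M" "space M = ultrafilters" "sets M = sigma_sets ultrafilters (range clopen)"
    and B: "countable B" "topological_basis B" "Int_stable B" "UNIV \<in> B"
    and eq: "\<And>U n. U \<in> B \<Longrightarrow> measure M (clopen {i. z i \<in> inner_part U n}) = measure P (inner_part U n)"
  shows "distr M P (\<lambda>u. Lim u z) = P"
proof -
  interpret P: prob_space P by fact
  interpret M: prob_space M by fact
  have z: "(\<lambda>u. Lim u z) \<in> measurable M P"
    using Lim_measurable[OF compact M(2,3), of z] measurable_cong_sets[OF refl P(2), of M] by blast
  have fin: "emeasure (distr M P (\<lambda>u. Lim u z)) UNIV \<noteq> \<infinity>"
    using M.prob_space_distr[OF z] unfolding infinity_ennreal_def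
    by (intro finite_measure.emeasure_finite prob_space.finite_measure)
  have clopen: "clopen A \<in> sets M" for A
    by (auto simp: M(3) intro: sigma_sets.Basic)
  have sB: "sets P = sigma_sets UNIV B"
    using P(2) arg_cong[OF borel_eq_countable_basis[OF B(1,2)], of sets] by simp
  show ?thesis
  proof (rule measure_eqI_generator_eq[where E = B and \<Omega> = UNIV and A = "\<lambda>_. UNIV"])
    fix U assume "U \<in> B"
    then have U: "open U" using B(2) by (simp add: topological_basis_open)
    have "(\<lambda>n. measure M (clopen {i. z i \<in> inner_part U n})) \<longlonglongrightarrow> measure M (\<Union>n. clopen {i. z i \<in> inner_part U n})"
      using incseq_inner_part[of U] clopen
      by (intro M.finite_Lim_measure_incseq) (auto simp: incseq_def intro!: clopen_mono)
    moreover have "(\<lambda>n. measure P (inner_part U n)) \<longlonglongrightarrow> measure P (\<Union>n. inner_part U n)"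
      by (intro P.finite_Lim_measure_incseq incseq_inner_part) (auto simp: P(2))
    ultimately have "measure M (\<Union>n. clopen {i. z i \<in> inner_part U n}) = measure P U"
      using eq[OF \<open>U \<in> B\<close>] by (simp add: UN_inner_part[OF U] LIMSEQ_unique)
    then have "measure M ((\<lambda>u. Lim u z) -` U \<inter> space M) = measure P U"
      by (simp add: M(2) Lim_vimage_open[OF compact U])
    moreover have "U \<in> sets P" using U by (simp add: P(2))
    ultimately show "emeasure (distr M P (\<lambda>u. Lim u z)) U = emeasure P U"
      by (simp add: emeasure_distr[OF z] M.emeasure_eq_measure P.emeasure_eq_measure)
  qed (use B(3,4) sB fin in simp_all)
qed

subsection \<open>Synchronization\<close>

text \<open>Invariance of the map says that the skew product after the graph embedding is the
  embedding after \<open>\<theta>\<close>, almost everywhere, and \<open>\<theta>\<close> preserves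
  \<open>P\<close>.\<close>

lemma graph_measure_invariant:
  fixes f :: "'w \<Rightarrow> 'x::topological_space \<Rightarrow> 'x"
  assumes rp: "random_product_of_maps P \<theta> f" and \<Phi>: "invariant_map P \<theta> f \<Phi>"
  shows "invariant_measure P \<theta> f (distr P (P \<Otimes>\<^sub>M borel) (\<lambda>\<omega>. (\<omega>, \<Phi> \<omega>)))"
proof -
  have sys: "measure_preserving_system P \<theta>" using rp by (simp add: random_product_of_maps_def)
  interpret P: prob_space P using sys by (simp add: measure_preserving_system_def)
  have \<theta> [measurable]: "\<theta> \<in> measurable P P" and pres: "distr P P \<theta> = P"
    using sys by (auto simp: measure_preserving_system_def)
  have f [measurable]: "(\<lambda>(\<omega>, x). f \<omega> x) \<in> measurable (P \<Otimes>\<^sub>M borel) borel"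
    using rp by (simp add: random_product_of_maps_def)
  have [measurable]: "\<Phi> \<in> measurable P borel" and AE: "AE \<omega> in P. f \<omega> (\<Phi> \<omega>) = \<Phi> (\<theta> \<omega>)"
    using \<Phi> by (auto simp: invariant_map_def)
  let ?N = "P \<Otimes>\<^sub>M (borel :: 'x measure)"
  let ?G = "\<lambda>\<omega>. (\<omega>, \<Phi> \<omega>)"
  have F [measurable]: "skew_product \<theta> f \<in> measurable ?N ?N"
    unfolding skew_product_def by measurable
  have G [measurable]: "?G \<in> measurable P ?N" by measurable
  \<comment> \<open>Of its target measure \<open>distr\<close> uses only the
    \<sigma>-algebra.\<close>
  have "distr (distr P ?N ?G) (distr P ?N ?G) (skew_product \<theta> f) = distr (distr P ?N ?G) ?N (skew_product \<theta> f)"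
    by (rule distr_cong) auto
  also have "\<dots> = distr P ?N (skew_product \<theta> f \<circ> ?G)"
    by (rule distr_distr) auto
  also have "\<dots> = distr P ?N (?G \<circ> \<theta>)"
    by (rule distr_cong_AE) (use AE in \<open>auto simp: skew_product_def elim: eventually_mono\<close>)
  also have "\<dots> = distr (distr P P \<theta>) ?N ?G"
    by (rule distr_distr[symmetric]) auto
  finally have inv: "distr (distr P ?N ?G) (distr P ?N ?G) (skew_product \<theta> f) = distr P ?N ?G"
    by (simp add: pres)
  have "distr (distr P ?N ?G) P fst = distr P P (fst \<circ> ?G)"
    by (rule distr_distr) auto
  also have "\<dots> = P" by (simp add: comp_def)
  finally show ?thesis
    using inv by (simp add: invariant_measure_def P.prob_space_distr)
qed

lemma Lim_filtermap_Suc: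
  fixes w :: "nat \<Rightarrow> 'w::metric_space"
  assumes u: "ultrafilter u" and lim: "((\<lambda>i. w (Suc i)) \<longlongrightarrow> l) u"
  shows "Lim (filtermap Suc u) w = l"
  by (rule tendsto_Lim)
    (use ultrafilter_not_bot[OF u] lim in \<open>auto simp: filtermap_bot_iff filterlim_filtermap\<close>)

text \<open>By continuity the extended orbit intertwines the shift on ultrafilters with the skew
  product, so shift invariance of \<open>M\<close> becomes invariance of the law.\<close>

lemma orbit_law_invariant:
  fixes P :: "'w::metric_space measure" and f :: "'w \<Rightarrow> 'x::metric_space \<Rightarrow> 'x"
  assumes cW: "compact (UNIV :: 'w set)" and cX: "compact (UNIV :: 'x set)"
    and P: "sets P = sets borel"
    and rp: "random_product_of_maps P \<theta> f"
    and cont: "continuous_on UNIV (skew_product \<theta> f)"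
    and M: "prob_space M" "space M = ultrafilters" "sets M = sigma_sets ultrafilters (range clopen)"
    and shift: "filtermap Suc \<in> measurable M M" "distr M M (filtermap Suc) = M"
    and w: "\<And>i. w (Suc i) = \<theta> (w i)" and a: "\<And>i. a (Suc i) = f (w i) (a i)"
    and marg: "distr M P (\<lambda>u. Lim u w) = P"
  shows "(\<lambda>u. (Lim u w, Lim u a)) \<in> measurable M (P \<Otimes>\<^sub>M borel)"
    and "invariant_measure P \<theta> f (distr M (P \<Otimes>\<^sub>M borel) (\<lambda>u. (Lim u w, Lim u a)))"
proof -
  interpret M: prob_space M by fact
  have [measurable]: "\<theta> \<in> measurable P P"
    using rp by (auto simp: random_product_of_maps_def measure_preserving_system_def)
  have [measurable]: "(\<lambda>(\<omega>, x). f \<omega> x) \<in> measurable (P \<Otimes>\<^sub>M borel) borel"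
    using rp by (simp add: random_product_of_maps_def)
  let ?N = "P \<Otimes>\<^sub>M (borel :: 'x measure)"
  let ?Z = "\<lambda>u. (Lim u w, Lim u a)"
  have [measurable]: "(\<lambda>u. Lim u w) \<in> measurable M P"
    using Lim_measurable[OF cW M(2,3), of w] measurable_cong_sets[OF refl P, of M] by blast
  have [measurable]: "(\<lambda>u. Lim u a) \<in> measurable M borel"
    by (rule Lim_measurable[OF cX M(2,3)])
  show Z [measurable]: "?Z \<in> measurable M ?N" by measurable
  have F [measurable]: "skew_product \<theta> f \<in> measurable ?N ?N"
    unfolding skew_product_def by measurable
  note shift(1) [measurable]
  have equi: "skew_product \<theta> f (?Z u) = ?Z (filtermap Suc u)" if "u \<in> space M" for u
  proof -
    have u: "ultrafilter u" using that by (simp add: M(2) ultrafilters_def)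
    have "((\<lambda>i. (w i, a i)) \<longlongrightarrow> ?Z u) u"
      by (intro tendsto_Pair tendsto_ultrafilter_Lim u cW cX)
    then have "((\<lambda>i. skew_product \<theta> f (w i, a i)) \<longlongrightarrow> skew_product \<theta> f (?Z u)) u"
      using cont by (auto intro: continuous_on_tendsto_compose)
    then have "((\<lambda>i. (w (Suc i), a (Suc i))) \<longlongrightarrow> skew_product \<theta> f (?Z u)) u"
      by (simp add: skew_product_def w a)
    from tendsto_fst[OF this] tendsto_snd[OF this] show ?thesis
      by (simp add: prod_eq_iff Lim_filtermap_Suc[OF u])
  qed
  have "distr (distr M ?N ?Z) (distr M ?N ?Z) (skew_product \<theta> f) = distr (distr M ?N ?Z) ?N (skew_product \<theta> f)"
    by (rule distr_cong) auto
  also have "\<dots> = distr M ?N (skew_product \<theta> f \<circ> ?Z)"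
    by (rule distr_distr) auto
  also have "\<dots> = distr M ?N (?Z \<circ> filtermap Suc)"
    by (rule distr_cong) (auto simp: equi)
  also have "\<dots> = distr (distr M M (filtermap Suc)) ?N ?Z"
    by (rule distr_distr[symmetric]) auto
  finally have inv: "distr (distr M ?N ?Z) (distr M ?N ?Z) (skew_product \<theta> f) = distr M ?N ?Z"
    by (simp add: shift)
  have "distr (distr M ?N ?Z) P fst = distr M P (fst \<circ> ?Z)"
    by (rule distr_distr) auto
  also have "\<dots> = P" by (simp add: comp_def marg)
  finally show "invariant_measure P \<theta> f (distr M ?N ?Z)"
    using inv by (simp add: invariant_measure_def M.prob_space_distr)
qed

text \<open>For a basic open \<open>A\<close>, the event that \<open>x\<close> and
  \<open>\<Phi> \<omega>\<close> agree on membership in \<open>A\<close> has full measure under the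
  graph law, hence under the law of \<open>(W, X)\<close>. Countably many such \<open>A\<close>
  separate points.\<close>

lemma AE_eq_of_distr_eq_graph:
  fixes X :: "'m \<Rightarrow> 'x::metric_space"
  assumes cX: "compact (UNIV :: 'x set)"
    and Z [measurable]: "(\<lambda>u. (W u, X u)) \<in> measurable M (P \<Otimes>\<^sub>M borel)"
    and \<Phi> [measurable]: "\<Phi> \<in> measurable P borel"
    and eq: "distr M (P \<Otimes>\<^sub>M borel) (\<lambda>u. (W u, X u)) = distr P (P \<Otimes>\<^sub>M borel) (\<lambda>\<omega>. (\<omega>, \<Phi> \<omega>))"
  shows "AE u in M. X u = \<Phi> (W u)"
proof -
  obtain B :: "'x set set" where B: "countable B" "topological_basis B"
    using compact_metric_countable_basis[OF cX] .
  have "AE u in M. X u \<in> A \<longleftrightarrow> \<Phi> (W u) \<in> A" if "A \<in> B" for A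
  proof -
    have [measurable]: "A \<in> sets borel"
      using that B(2) by (simp add: topological_basis_open)
    have S: "{p \<in> space (P \<Otimes>\<^sub>M (borel :: 'x measure)). snd p \<in> A \<longleftrightarrow> \<Phi> (fst p) \<in> A} \<in> sets (P \<Otimes>\<^sub>M borel)"
      by measurable
    have "AE p in distr P (P \<Otimes>\<^sub>M borel) (\<lambda>\<omega>. (\<omega>, \<Phi> \<omega>)). snd p \<in> A \<longleftrightarrow> \<Phi> (fst p) \<in> A"
      by (subst AE_distr_iff[OF _ S]) auto
    then show ?thesis
      unfolding eq[symmetric] by (subst (asm) AE_distr_iff[OF Z S]) simp
  qed
  then have "AE u in M. \<forall>A\<in>B. X u \<in> A \<longleftrightarrow> \<Phi> (W u) \<in> A"
    using B(1) by (simp add: AE_ball_countable)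
  then show ?thesis
  proof eventually_elim
    case (elim u)
    show ?case
    proof (rule ccontr)
      assume "X u \<noteq> \<Phi> (W u)"
      then obtain U where "open U" "X u \<in> U" "\<Phi> (W u) \<notin> U"
        using t1_space by blast
      then show False
        using B(2) elim by (metis subsetD topological_basisE)
    qed
  qed
qed

text \<open>Countability of \<open>B\<close> gives one null set for all inner parts, the sets
  compared in \<open>distr_Lim_eq\<close>.\<close>

lemma AE_birkhoff_generic:
  fixes P :: "'w::metric_space measure"
  assumes erg: "ergodic_system P \<theta>" and P: "sets P = sets borel" and B: "countable B"
  shows "AE \<omega> in P. \<forall>U\<in>B. \<forall>n. frequency {i. (\<theta> ^^ i) \<omega> \<in> inner_part U n} \<longlonglongrightarrow> measure P (inner_part U n)"
proof -
  have "AE \<omega> in P. frequency {i. (\<theta> ^^ i) \<omega> \<in> inner_part U n} \<longlonglongrightarrow> measure P (inner_part U n)" for U n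
  proof -
    have [measurable]: "inner_part U n \<in> sets P" by (simp add: P)
    have "AE \<omega> in P. (\<lambda>N. (\<Sum>i<N. indicator (inner_part U n) ((\<theta> ^^ i) \<omega>)) / N)
        \<longlonglongrightarrow> (\<integral>\<omega>. indicator (inner_part U n) \<omega> \<partial>P :: real)"
      by (rule birkhoff_ergodic[OF erg, where B = 1]) (auto simp: indicator_def)
    moreover have "(\<integral>\<omega>. indicator (inner_part U n) \<omega> \<partial>P :: real) = measure P (inner_part U n)"
      using sets_eq_imp_space_eq[OF P] by simp
    ultimately show ?thesis
      by (simp flip: frequency_eq_sum)
  qed
  then show ?thesis
    using B by (simp add: AE_ball_countable AE_all_countable)
qed

text \<open>Terms below \<open>e\<close> contribute at most \<open>e\<close> to the average, the
  others at most \<open>D\<close> each.\<close>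

lemma average_le_frequency:
  fixes d :: "nat \<Rightarrow> real"
  assumes "\<And>i. d i \<le> D" "D \<ge> 0" "e \<ge> 0"
  shows "(\<Sum>i<n. d i) / n \<le> e + D * frequency {i. d i \<ge> e} n"
proof (cases "n = 0")
  case False
  have "(\<Sum>i<n. d i) \<le> (\<Sum>i<n. e + D * indicator {e..} (d i))"
    using assms by (intro sum_mono) (auto simp: indicator_def add_increasing)
  also have "\<dots> = n * e + D * (\<Sum>i<n. indicator {e..} (d i))"
    by (simp add: sum.distrib sum_distrib_left)
  finally have "(\<Sum>i<n. d i) / n \<le> (n * e + D * (\<Sum>i<n. indicator {e..} (d i))) / n"
    by (rule divide_right_mono) simp
  also have "\<dots> = e + D * frequency {i. d i \<in> {e..}} n"
    using False unfolding frequency_eq_sum by (simp add: add_divide_distrib)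
  finally show ?thesis by simp
qed (use assms in \<open>simp add: frequency_def\<close>)

text \<open>The argument for a single generic base orbit \<open>w\<close>. Genericity does not
  involve the fibre orbits \<open>a\<close> and \<open>b\<close>, which are arbitrary.\<close>

lemma average_dist_tendsto_0:
  fixes P :: "'w::metric_space measure" and f :: "'w \<Rightarrow> 'x::metric_space \<Rightarrow> 'x"
  assumes cW: "compact (UNIV :: 'w set)" and cX: "compact (UNIV :: 'x set)"
    and P: "sets P = sets borel"
    and rp: "random_product_of_maps P \<theta> f"
    and cont: "continuous_on UNIV (skew_product \<theta> f)"
    and \<Phi>: "invariant_map P \<theta> f \<Phi>"
    and unique: "\<exists>!\<mu>. invariant_measure P \<theta> f \<mu>"
    and B: "countable B" "topological_basis B" "Int_stable B" "UNIV \<in> B"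
    and w: "\<And>i. w (Suc i) = \<theta> (w i)"
    and a: "\<And>i. a (Suc i) = f (w i) (a i)" and b: "\<And>i. b (Suc i) = f (w i) (b i)"
    and generic: "\<And>U n. U \<in> B \<Longrightarrow> frequency {i. w i \<in> inner_part U n} \<longlonglongrightarrow> measure P (inner_part U n)"
  shows "(\<lambda>n. (\<Sum>i<n. dist (a i) (b i)) / n) \<longlonglongrightarrow> 0"
proof (rule ccontr)
  let ?d = "\<lambda>i. dist (a i) (b i)"
  let ?avg = "\<lambda>n. (\<Sum>i<n. ?d i) / n"
  have avg_nonneg: "?avg n \<ge> 0" for n by (simp add: sum_nonneg)
  assume "\<not> ?avg \<longlonglongrightarrow> 0"
  then obtain e where e: "e > 0" "\<not> eventually (\<lambda>n. ?avg n < e) sequentially"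
    by (auto simp: tendsto_iff dist_norm abs_of_nonneg[OF avg_nonneg] simp del: abs_divide)
  \<comment> \<open>Failure of convergence makes the averages reach \<open>e\<close> at arbitrarily
    late times.\<close>
  have "inf sequentially (principal {n. ?avg n \<ge> e}) \<noteq> bot"
    using e(2) by (simp add: trivial_limit_def eventually_inf_principal not_le)
  then obtain V where V: "ultrafilter V" "V \<le> inf sequentially (principal {n. ?avg n \<ge> e})"
    by (rule ultrafilter_exists)
  then have seq: "V \<le> sequentially" and ev: "eventually (\<lambda>n. ?avg n \<ge> e) V"
    by (auto simp: le_principal)
  have nb: "V \<noteq> bot" using V(1) by (rule ultrafilter_not_bot)
  obtain M where M: "prob_space M" "space M = ultrafilters" "sets M = sigma_sets ultrafilters (range clopen)"
    and freq: "\<And>A. (frequency A \<longlongrightarrow> measure M (clopen A)) V"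
    and shift: "filtermap Suc \<in> measurable M M" "distr M M (filtermap Suc) = M"
    using frequency_measure_exists[OF V(1) seq] by metis
  interpret M: prob_space M by fact
  have prob: "prob_space P"
    using rp by (simp add: random_product_of_maps_def measure_preserving_system_def)
  \<comment> \<open>Genericity is convergence along the tail filter, hence along the finer
    \<open>V\<close>.\<close>
  have marg: "distr M P (\<lambda>u. Lim u w) = P"
    by (rule distr_Lim_eq[OF cW prob P M B])
      (rule tendsto_unique[OF nb freq tendsto_mono[OF seq generic]])
  have \<Phi>': "\<Phi> \<in> measurable P borel" using \<Phi> by (simp add: invariant_map_def)
  have AE: "AE u in M. Lim u c = \<Phi> (Lim u w)" if c: "\<And>i. c (Suc i) = f (w i) (c i)" for c
  proof (rule AE_eq_of_distr_eq_graph[OF cX _ \<Phi>'])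
    note law = orbit_law_invariant[OF cW cX P rp cont M shift w c marg]
    show "(\<lambda>u. (Lim u w, Lim u c)) \<in> measurable M (P \<Otimes>\<^sub>M borel)" by (rule law(1))
    show "distr M (P \<Otimes>\<^sub>M borel) (\<lambda>u. (Lim u w, Lim u c)) = distr P (P \<Otimes>\<^sub>M borel) (\<lambda>\<omega>. (\<omega>, \<Phi> \<omega>))"
      using unique law(2) graph_measure_invariant[OF rp \<Phi>] by blast
  qed
  \<comment> \<open>Distances below \<open>e / 2\<close> explain at most half of an average of size
    \<open>e\<close>; the rest must come from the frequency of \<open>A\<close>.\<close>
  define A where "A = {i. ?d i \<ge> e / 2}"
  have clopen: "clopen A \<in> sets M" by (auto simp: M(3) intro: sigma_sets.Basic)
  have "AE u in M. u \<notin> clopen A"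
    using AE[OF a] AE[OF b]
  proof eventually_elim
    case (elim u)
    show ?case
    proof
      assume "u \<in> clopen A"
      then have u: "ultrafilter u" "eventually (\<lambda>i. ?d i \<ge> e / 2) u"
        by (auto simp: clopen_def A_def)
      have "(?d \<longlongrightarrow> dist (Lim u a) (Lim u b)) u"
        by (intro tendsto_dist tendsto_ultrafilter_Lim u cX)
      then have "dist (Lim u a) (Lim u b) \<ge> e / 2"
        using u(2) ultrafilter_not_bot[OF u(1)] by (rule tendsto_lowerbound)
      with elim e show False by simp
    qed
  qed
  then have null: "measure M (clopen A) = 0"
    using clopen by (simp add: M.prob_eq_0)
  obtain D where D: "\<And>x y :: 'x. dist x y \<le> D"
    using compact_imp_bounded[OF cX] by (meson UNIV_I bounded_two_points)
  have "D \<ge> 0" using D[of "a 0" "a 0"] by simp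
  have "((\<lambda>n. e / 2 + D * frequency A n) \<longlongrightarrow> e / 2 + D * measure M (clopen A)) V"
    by (intro tendsto_intros freq)
  moreover have "eventually (\<lambda>n. e \<le> e / 2 + D * frequency A n) V"
    using ev
  proof eventually_elim
    case (elim n)
    then show ?case
      using average_le_frequency[of ?d D "e / 2" n] D \<open>D \<ge> 0\<close> e by (simp add: A_def)
  qed
  ultimately have "e \<le> e / 2 + D * measure M (clopen A)"
    using nb by (rule tendsto_lowerbound)
  with e null show False by simp
qed

theorem theorem3:
  fixes P :: "'w::metric_space measure"
    and \<theta> :: "'w \<Rightarrow> 'w"
    and f :: "'w \<Rightarrow> 'x::metric_space \<Rightarrow> 'x"
  assumes "compact (UNIV :: 'w set)"
    and "compact (UNIV :: 'x set)"
    and "sets P = sets borel"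
    and "invertible_system P \<theta>"
    and "ergodic_system P \<theta>"
    and "random_product_of_maps P \<theta> f"
    and "continuous_on UNIV (skew_product \<theta> f)"
    and "\<exists>G. invariant_graph P \<theta> f G"
    and "\<exists>!\<mu>. invariant_measure P \<theta> f \<mu>"
  shows "strongly_synchronizing_on_average P \<theta> f"
proof -
  obtain B :: "'w set set" where B: "countable B" "topological_basis B" "Int_stable B" "UNIV \<in> B"
    using compact_metric_Int_stable_basis[OF assms(1)] .
  obtain \<Phi> where \<Phi>: "invariant_map P \<theta> f \<Phi>"
    using assms(8) by (auto simp: invariant_graph_def)
  show ?thesis
    unfolding strongly_synchronizing_on_average_def
    using AE_birkhoff_generic[OF assms(5) assms(3) B(1)]
  proof eventually_elim
    case (elim \<omega>)
    show ?case
    proof (intro allI)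
      \<comment> \<open>The null set has been fixed before \<open>x\<close> and \<open>y\<close>, as
        strong synchronization demands.\<close>
      fix x y
      have "(\<lambda>n. (\<Sum>i<n. dist (random_product \<theta> f i \<omega> x) (random_product \<theta> f i \<omega> y)) / real n) \<longlonglongrightarrow> 0"
        by (rule average_dist_tendsto_0[OF assms(1,2,3,6,7) \<Phi> assms(9) B, where w = "\<lambda>i. (\<theta> ^^ i) \<omega>"])
          (use elim in auto)
      then show "(\<lambda>n. (1 / real n) *
           (\<Sum>i<n. dist (random_product \<theta> f i \<omega> x) (random_product \<theta> f i \<omega> y))) \<longlonglongrightarrow> 0"
        by simp
    qed
  qed
qed

end
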